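(* Let $1<q<p<\infty$, $\frac1r:=\frac1q-\frac1p$, let $v,w\ge0$ be weight functions on $\mathbb{R}^2_+$ and $\sigma:=v^{1-p'}$, with $I_2\sigma(x,y)<\infty$ and $I_2^\ast w(x,y)<\infty$ for every $(x,y)\in\mathbb{R}^2_+$. If $$B_v:=\Bigl(\int_{\mathbb{R}^2_+}\sigma(u,z)\Bigl(\int_u^\infty\int_z^\infty (I_2\sigma)^{q-1}w\Bigr)^{r/q}du\,dz\Bigr)^{1/r}<\infty,$$ then the inequality $$\Bigl(\int_{\mathbb{R}^2_+}(I_2f)^q\,w\Bigr)^{1/q}\le C_2\Bigl(\int_{\mathbb{R}^2_+}f^p\,v\Bigr)^{1/p}$$ holds for all measurable $f\ge0$ on $\mathbb{R}^2_+$ with some finite constant independent of $f$, and its least constant $C_2$ satisfies $C_2\le c\,B_v$, where $c>0$ is a constant that may depend on $p$ and $q$ but not on $v$ and $w$.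
   Context: Notation: $\mathbb{R}^2_+=(0,\infty)^2$; $p'=p/(p-1)$. A weight function is a non-negative measurable function on $\mathbb{R}^2_+$. For measurable $f\ge0$, $$I_2f(x,y)=\int_0^x\int_0^y f(s,t)\,dt\,ds,\qquad I_2^\ast f(x,y)=\int_x^\infty\int_y^\infty f(s,t)\,dt\,ds .$$ *)

theory Defs
  imports "HOL-Analysis.Analysis"
begin

definition R2plus :: "(real \<times> real) set" where
  "R2plus = {0<..} \<times> {0<..}"

text \<open>
  Real powers of extended non-negative numbers. In contrast to \<^const>\<open>powr\<close> on the reals
  (where a power of 0 is always 0), a negative power of 0 is infinite; this matters where a weight
  vanishes. Products of extended non-negative numbers follow the usual convention
  that 0 times infinity is 0.
\<close>

definition ennpowr :: "ennreal \<Rightarrow> real \<Rightarrow> ennreal" (infixr "ennpowr" 80) where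
  "x ennpowr a =
     (if a = 0 then 1
      else if x = 0 then (if a > 0 then 0 else top)
      else if x = top then (if a > 0 then top else 0)
      else ennreal (enn2real x powr a))"

text \<open>
  Measurability is Lebesgue measurability. Weights are finite-valued, and only their values
  on the open quadrant are ever used. The functions \<open>f\<close> in the inequality may take the value infinity.
\<close>

definition weight_on_quadrant :: "(real \<times> real \<Rightarrow> real) \<Rightarrow> bool" where
  "weight_on_quadrant v \<longleftrightarrow>
     v \<in> borel_measurable (lebesgue_on R2plus) \<and> (\<forall>z\<in>R2plus. 0 \<le> v z)"

definition I2 :: "(real \<times> real \<Rightarrow> ennreal) \<Rightarrow> real \<times> real \<Rightarrow> ennreal" where
  "I2 f = (\<lambda>(x, y). \<integral>\<^sup>+s\<in>{0<..<x}. (\<integral>\<^sup>+t\<in>{0<..<y}. f (s, t) \<partial>lebesgue) \<partial>lebesgue)"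

definition I2_star :: "(real \<times> real \<Rightarrow> ennreal) \<Rightarrow> real \<times> real \<Rightarrow> ennreal" where
  "I2_star f = (\<lambda>(x, y). \<integral>\<^sup>+s\<in>{x<..}. (\<integral>\<^sup>+t\<in>{y<..}. f (s, t) \<partial>lebesgue) \<partial>lebesgue)"

definition conj_exponent :: "real \<Rightarrow> real" where
  "conj_exponent p = p / (p - 1)"

definition sigma_weight :: "real \<Rightarrow> (real \<times> real \<Rightarrow> real) \<Rightarrow> real \<times> real \<Rightarrow> ennreal" where
  "sigma_weight p v z = ennreal (v z) ennpowr (1 - conj_exponent p)"

definition B_v ::
    "real \<Rightarrow> real \<Rightarrow> real \<Rightarrow> (real \<times> real \<Rightarrow> real) \<Rightarrow> (real \<times> real \<Rightarrow> real) \<Rightarrow> ennreal" where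
  "B_v p q r v w =
     (\<integral>\<^sup>+z\<in>R2plus.
        (sigma_weight p v z *
         (I2_star (\<lambda>x. (I2 (sigma_weight p v) x) ennpowr (q - 1) * ennreal (w x)) z) ennpowr (r / q))
      \<partial>lebesgue) ennpowr (1 / r)"

definition hardy_inequality ::
    "real \<Rightarrow> real \<Rightarrow> (real \<times> real \<Rightarrow> real) \<Rightarrow> (real \<times> real \<Rightarrow> real) \<Rightarrow> ennreal \<Rightarrow> bool" where
  "hardy_inequality p q v w C \<longleftrightarrow>
     (\<forall>f :: real \<times> real \<Rightarrow> ennreal. f \<in> borel_measurable (lebesgue_on R2plus) \<longrightarrow>
        (\<integral>\<^sup>+z\<in>R2plus. ((I2 f z) ennpowr q * ennreal (w z)) \<partial>lebesgue) ennpowr (1 / q)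
        \<le> C * (\<integral>\<^sup>+z\<in>R2plus. ((f z) ennpowr p * ennreal (v z)) \<partial>lebesgue) ennpowr (1 / p))"

definition least_constant ::
    "real \<Rightarrow> real \<Rightarrow> (real \<times> real \<Rightarrow> real) \<Rightarrow> (real \<times> real \<Rightarrow> real) \<Rightarrow> ennreal" where
  "least_constant p q v w = Inf {C. C < top \<and> hardy_inequality p q v w C}"

end

theory Submission
  imports Defs
begin

text \<open>
  Jensen's inequality for the measure \<open>\<sigma>\<close> on the rectangle below \<open>x\<close> gives
  \<open>(I2 f)\<^sup>q \<le> (I2 \<sigma>)\<^bsup>q-1\<^esup> I2 (f\<^sup>q \<sigma>\<^bsup>1-q\<^esup>)\<close>. After multiplying by \<open>w\<close>, integrating and applying
  Tonelli, the left-hand side is at most \<open>\<integral> f\<^sup>q \<sigma>\<^bsup>1-q\<^esup> H\<close> with \<open>H = I2_star ((I2 \<sigma>)\<^bsup>q-1\<^esup> w)\<close>, and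
  Hoelder's inequality with exponents \<open>p/q\<close> and \<open>r/q\<close> bounds this by
  \<open>(\<integral> f\<^sup>p v)\<^bsup>q/p\<^esup> B_v\<^sup>q\<close>. So the constant \<open>c = 1\<close> works.
\<close>

section \<open>Powers of extended non-negative numbers\<close>

text \<open>These are the three regimes of \<open>ennpowr\<close>. The split reduces each power law
  to \<open>powr\<close> on positive reals plus the boundary values.\<close>

lemma ennreal_cases3 [case_names zero top pos]:
  fixes x :: ennreal
  obtains "x = 0" | "x = top" | t where "t > 0" "x = ennreal t"
  by (cases x) (metis ennreal_0 less_le that)+

lemma ennpowr_ennreal: "t > 0 \<Longrightarrow> ennreal t ennpowr a = ennreal (t powr a)"
  by (auto simp: ennpowr_def)

lemma ennpowr_0 [simp]: "a > 0 \<Longrightarrow> 0 ennpowr a = 0"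
  and ennpowr_top [simp]: "a > 0 \<Longrightarrow> top ennpowr a = top"
  and ennpowr_1 [simp]: "x ennpowr 1 = x"
  by (auto simp: ennpowr_def less_top)

text \<open>For a negative exponent the convention 0 * infinity = 0 breaks the rule: at x = 0, y =
  \<open>top\<close> the left side is infinite and the right side 0.\<close>

lemma ennpowr_mult: "a > 0 \<Longrightarrow> (x * y) ennpowr a = x ennpowr a * y ennpowr a"
  by (cases x rule: ennreal_cases3; cases y rule: ennreal_cases3)
    (auto simp: ennpowr_ennreal powr_mult ennreal_mult_top ennreal_top_mult
      simp flip: ennreal_mult'')

lemma ennpowr_ennpowr:
  "(a > 0 \<and> b > 0) \<or> (0 < x \<and> x < top) \<Longrightarrow> (x ennpowr a) ennpowr b = x ennpowr (a * b)"
  by (cases x rule: ennreal_cases3) (auto simp: ennpowr_ennreal powr_powr)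

text \<open>The bounds exclude 0 * infinity: with exponents 1 and -1 the left side would be 0 at x =
  0 or x = \<open>top\<close>, the right side 1. Applying this rule to \<sigma> is why \<sigma> must
  be positive and finite almost everywhere.\<close>

lemma ennpowr_add: "0 < x \<Longrightarrow> x < top \<Longrightarrow> x ennpowr a * x ennpowr b = x ennpowr (a + b)"
  by (cases x rule: ennreal_cases3) (auto simp: ennpowr_ennreal powr_add simp flip: ennreal_mult'')

lemma ennpowr_mono: "a > 0 \<Longrightarrow> x \<le> y \<Longrightarrow> x ennpowr a \<le> y ennpowr a"
  by (cases x rule: ennreal_cases3; cases y rule: ennreal_cases3)
    (auto simp: ennpowr_ennreal top_unique intro!: powr_mono2 ennreal_leI)

lemma ennpowr_eq_0_iff: "a > 0 \<Longrightarrow> x ennpowr a = 0 \<longleftrightarrow> x = 0"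
  by (cases x rule: ennreal_cases3) (auto simp: ennpowr_ennreal)

lemma ennpowr_less_top: "a > 0 \<Longrightarrow> x < top \<Longrightarrow> x ennpowr a < top"
  by (cases x rule: ennreal_cases3) (auto simp: ennpowr_ennreal)

lemma borel_measurable_ennpowr [measurable (raw)]:
  assumes [measurable]: "f \<in> borel_measurable M"
  shows "(\<lambda>x. f x ennpowr a) \<in> borel_measurable M"
  unfolding ennpowr_def by measurable

section \<open>Young's and Hoelder's inequalities for extended non-negative functions\<close>

lemma ennpowr_young:
  assumes "0 < \<alpha>" "\<alpha> < 1"
  shows "x ennpowr \<alpha> * y ennpowr (1 - \<alpha>) \<le> ennreal \<alpha> * x + ennreal (1 - \<alpha>) * y"
\<comment> \<open>If a factor is 0, the left side is 0; if x or y is infinite, so is the right side,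
  since both coefficients are positive.\<close>
proof (cases x rule: ennreal_cases3; cases y rule: ennreal_cases3)
  fix s t assume "s > 0" "x = ennreal s" "t > 0" "y = ennreal t"
  then show ?thesis
    using Youngs_inequality_0[of \<alpha> "1 - \<alpha>" s t] assms
    by (auto simp: ennpowr_ennreal ennreal_leI simp flip: ennreal_mult'' ennreal_plus)
qed (use assms in \<open>auto simp: ennreal_mult_top\<close>)

text \<open>Normalise both integrals to 1 and integrate Young's inequality. No finiteness is
  assumed, so the degenerate values of the two integrals are separate cases.\<close>

theorem nn_integral_Hoelder:
  assumes \<alpha>: "0 < \<alpha>" "\<alpha> < 1"
    and [measurable]: "f \<in> borel_measurable M" "g \<in> borel_measurable M"
  shows "(\<integral>\<^sup>+x. f x ennpowr \<alpha> * g x ennpowr (1 - \<alpha>) \<partial>M)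
    \<le> (\<integral>\<^sup>+x. f x \<partial>M) ennpowr \<alpha> * (\<integral>\<^sup>+x. g x \<partial>M) ennpowr (1 - \<alpha>)" (is "?L \<le> ?A ennpowr \<alpha> * ?B ennpowr _")
proof -
  \<comment> \<open>If one integral vanishes, the right side is 0 even when the other is infinite,
    so the left integrand has to vanish almost everywhere.\<close>
  have zero: "?L = 0" if "?A = 0 \<or> ?B = 0"
  proof -
    have "AE x in M. f x ennpowr \<alpha> * g x ennpowr (1 - \<alpha>) = 0"
      using that
    proof
      assume "?A = 0"
      then have "AE x in M. f x = 0" by (simp add: nn_integral_0_iff_AE)
      then show ?thesis by eventually_elim (use \<alpha> in simp)
    next
      assume "?B = 0"
      then have "AE x in M. g x = 0" by (simp add: nn_integral_0_iff_AE)
      then show ?thesis by eventually_elim (use \<alpha> in simp)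
    qed
    then show ?thesis by (subst nn_integral_0_iff_AE) auto
  qed
  show ?thesis
  proof (cases "?A" rule: ennreal_cases3; cases "?B" rule: ennreal_cases3)
    fix A B assume A: "A > 0" "?A = ennreal A" and B: "B > 0" "?B = ennreal B"
    let ?c = "ennreal (A powr \<alpha> * B powr (1 - \<alpha>))"
    \<comment> \<open>Homogeneity lets f / A and g / B, both of integral 1, replace f and g; the
      integrated bound is then \<open>?c\<close> times \<alpha> + (1 - \<alpha>) = 1.\<close>
    have scale: "z ennpowr a = ennreal (C powr a) * (ennreal (1 / C) * z) ennpowr a"
      if "C > 0" "a > 0" for z C a
      using that by (simp add: ennpowr_mult ennpowr_ennreal powr_divide
          flip: mult.assoc ennreal_mult'')
    have "f x ennpowr \<alpha> * g x ennpowr (1 - \<alpha>)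
        \<le> ?c * (ennreal (\<alpha> / A) * f x + ennreal ((1 - \<alpha>) / B) * g x)" for x
    proof -
      have "f x ennpowr \<alpha> * g x ennpowr (1 - \<alpha>)
          = ?c * ((ennreal (1 / A) * f x) ennpowr \<alpha> * (ennreal (1 / B) * g x) ennpowr (1 - \<alpha>))"
        using A B \<alpha> by (subst scale[of A \<alpha>], simp, simp, subst scale[of B "1 - \<alpha>"])
          (auto simp: ennreal_mult ac_simps)
      also have "\<dots> \<le> ?c * (ennreal \<alpha> * (ennreal (1 / A) * f x) + ennreal (1 - \<alpha>) * (ennreal (1 / B) * g x))"
        by (intro mult_left_mono ennpowr_young \<alpha>) simp
      also have "\<dots> = ?c * (ennreal (\<alpha> / A) * f x + ennreal ((1 - \<alpha>) / B) * g x)"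
        using A B \<alpha> by (simp flip: mult.assoc ennreal_mult'')
      finally show ?thesis .
    qed
    then have "?L \<le> (\<integral>\<^sup>+x. ?c * (ennreal (\<alpha> / A) * f x + ennreal ((1 - \<alpha>) / B) * g x) \<partial>M)"
      by (intro nn_integral_mono)
    also have "\<dots> = ?c * (ennreal (\<alpha> / A) * ennreal A + ennreal ((1 - \<alpha>) / B) * ennreal B)"
      by (simp add: nn_integral_cmult nn_integral_add A B)
    also have "\<dots> = ?c"
      using A B \<alpha> by (simp flip: ennreal_mult'' ennreal_plus)
    finally show ?thesis
      using A B by (simp add: ennpowr_ennreal ennreal_mult)
  qed (use \<alpha> zero in \<open>auto simp: ennpowr_ennreal ennreal_mult_top ennreal_top_mult\<close>)
qed

section \<open>Rectangular integrals of Lebesgue measurable functions\<close>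

abbreviation rect :: "real \<times> real \<Rightarrow> (real \<times> real) set" where
  "rect x \<equiv> {0<..<fst x} \<times> {0<..<snd x}"

lemma rect_indicator:
  "indicator (rect x) z = (if 0 < fst z \<and> 0 < snd z \<and> fst z < fst x \<and> snd z < snd x then 1 else (0::ennreal))"
  by (auto simp: indicator_def mem_Times_iff)

lemma sets_R2plus [measurable]: "R2plus \<in> sets borel"
  by (auto simp: R2plus_def intro!: borel_open open_Times)

text \<open>Joint measurability and Tonelli are applied to Borel functions only; almost everywhere
  equality then carries the results back to Lebesgue measurable ones.\<close>

lemma borel_version:
  fixes f :: "real \<times> real \<Rightarrow> ennreal"
  assumes "f \<in> borel_measurable (lebesgue_on R2plus)"
  obtains f' where "f' \<in> borel_measurable borel" "AE z in lborel. z \<in> R2plus \<longrightarrow> f z = f' z"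
proof -
  have "(\<lambda>z. f z * indicator R2plus z) \<in> borel_measurable lebesgue"
    using assms by (subst (asm) borel_measurable_restrict_space_iff_ennreal) (auto simp: sets_R2plus)
  from completion_ex_borel_measurable[OF this] obtain f' where
    f': "f' \<in> borel_measurable lborel" "AE z in lborel. f z * indicator R2plus z = f' z" by blast
  from f'(2) have "AE z in lborel. z \<in> R2plus \<longrightarrow> f z = f' z"
    by eventually_elim (auto split: split_indicator)
  with f'(1) show ?thesis by (intro that) auto
qed

text \<open>Sections of a Lebesgue measurable function need not be measurable. A null set of the
  plane has null sections for almost every s, however, so both iterated integrals can be computed
  with a Borel version, to which Tonelli applies.\<close>

lemma iterated_eq_rectangle_integral:
  fixes f :: "real \<times> real \<Rightarrow> ennreal"
  assumes f: "f \<in> borel_measurable (lebesgue_on R2plus)"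
    and [measurable]: "A \<in> sets borel" "B \<in> sets borel" and AB: "A \<times> B \<subseteq> R2plus"
  shows "(\<integral>\<^sup>+s\<in>A. (\<integral>\<^sup>+t\<in>B. f (s, t) \<partial>lebesgue) \<partial>lebesgue) = (\<integral>\<^sup>+z\<in>A \<times> B. f z \<partial>lborel)"
proof -
  obtain f' where [measurable]: "f' \<in> borel_measurable borel"
    and eq: "AE z in lborel. z \<in> R2plus \<longrightarrow> f z = f' z"
    using borel_version[OF f] by blast
  have "A \<times> B \<in> sets (borel \<Otimes>\<^sub>M borel)" by measurable
  then have [measurable]: "A \<times> B \<in> sets borel" unfolding borel_prod .
  have meas: "(\<lambda>z. f' z * indicator (A \<times> B) z) \<in> borel_measurable (lborel \<Otimes>\<^sub>M lborel)"
    unfolding lborel_prod by measurable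
  have "AE z in lborel \<Otimes>\<^sub>M lborel. z \<in> R2plus \<longrightarrow> f z = f' z"
    unfolding lborel_prod by (rule eq)
  then have "AE s in lborel. AE t in lborel. (s, t) \<in> R2plus \<longrightarrow> f (s, t) = f' (s, t)"
    by (rule lborel_pair.AE_pair)
  then have "AE s in lborel. (\<integral>\<^sup>+t\<in>B. f (s, t) \<partial>lborel) * indicator A s
      = (\<integral>\<^sup>+t. f' (s, t) * indicator (A \<times> B) (s, t) \<partial>lborel)"
  proof eventually_elim
    case (elim s)
    show ?case
    proof (cases "s \<in> A")
      case True
      have "AE t in lborel. f (s, t) * indicator B t = f' (s, t) * indicator (A \<times> B) (s, t)"
        using elim by eventually_elim (use True AB in \<open>auto split: split_indicator\<close>)
      then show ?thesis using True by (auto intro!: nn_integral_cong_AE)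
    qed auto
  qed
  then have "(\<integral>\<^sup>+s\<in>A. (\<integral>\<^sup>+t\<in>B. f (s, t) \<partial>lebesgue) \<partial>lebesgue)
      = (\<integral>\<^sup>+s. \<integral>\<^sup>+t. f' (s, t) * indicator (A \<times> B) (s, t) \<partial>lborel \<partial>lborel)"
    unfolding nn_integral_completion by (rule nn_integral_cong_AE)
  also have "\<dots> = (\<integral>\<^sup>+z. f' z * indicator (A \<times> B) z \<partial>lborel)"
    using lborel.nn_integral_fst[OF meas] by (simp add: lborel_prod)
  also have "\<dots> = (\<integral>\<^sup>+z\<in>A \<times> B. f z \<partial>lborel)"
    by (rule nn_integral_cong_AE, use eq in eventually_elim) (use AB in \<open>auto split: split_indicator\<close>)
  finally show ?thesis .
qed

lemma I2_eq:
  assumes "f \<in> borel_measurable (lebesgue_on R2plus)"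
  shows "I2 f x = (\<integral>\<^sup>+z. f z * indicator (rect x) z \<partial>lborel)"
  unfolding I2_def case_prod_unfold
  by (rule iterated_eq_rectangle_integral[OF assms]) (auto simp: R2plus_def)

text \<open>For z in the quadrant, x lies beyond z in both coordinates iff z lies in
  \<open>rect x\<close>. Thus \<open>I2\<close> and \<open>I2_star\<close> have the same kernel,
  integrated in different variables, which gives their duality by Tonelli.\<close>

lemma I2_star_eq:
  assumes "f \<in> borel_measurable (lebesgue_on R2plus)" and z: "z \<in> R2plus"
  shows "I2_star f z = (\<integral>\<^sup>+x. f x * indicator (rect x) z \<partial>lborel)"
proof -
  have "I2_star f z = (\<integral>\<^sup>+x\<in>{fst z<..} \<times> {snd z<..}. f x \<partial>lborel)"
    unfolding I2_star_def case_prod_unfold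
    by (rule iterated_eq_rectangle_integral[OF assms(1)]) (use z in \<open>auto simp: R2plus_def\<close>)
  also have "\<dots> = (\<integral>\<^sup>+x. f x * indicator (rect x) z \<partial>lborel)"
    by (intro nn_integral_cong) (use z in \<open>auto simp: rect_indicator R2plus_def split: split_indicator\<close>)
  finally show ?thesis .
qed

lemma measurable_rect_indicator [measurable (raw)]:
  assumes [measurable]: "g \<in> borel_measurable M" "h \<in> borel_measurable M"
  shows "(\<lambda>y. indicator (rect (g y)) (h y) :: ennreal) \<in> borel_measurable M"
proof -
  have [measurable]: "(\<lambda>y. fst (k y)) \<in> borel_measurable M" "(\<lambda>y. snd (k y)) \<in> borel_measurable M"
    if [measurable]: "k \<in> borel_measurable M" for k :: "'a \<Rightarrow> real \<times> real"
    by (rule borel_measurable_continuous_on[OF _ that]; intro continuous_intros)+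
  show ?thesis unfolding rect_indicator by measurable
qed

lemma rect_integral_cong:
  assumes "AE z in lborel. z \<in> R2plus \<longrightarrow> f z = g z"
  shows "(\<integral>\<^sup>+z. f z * indicator (rect x) z \<partial>lborel) = (\<integral>\<^sup>+z. g z * indicator (rect x) z \<partial>lborel)"
  by (rule nn_integral_cong_AE, use assms in eventually_elim)
    (auto simp: R2plus_def split: split_indicator)

section \<open>The inequality for Borel functions\<close>

text \<open>Here S, F, H stand for \<open>I2 \<sigma>\<close>, \<open>I2 f\<close> and the inner
  \<open>I2_star\<close> of \<open>B_v\<close>, the weight v appears as
  \<open>\<sigma> ennpowr (1 - p)\<close>, and the root of order q is not yet taken.\<close>

lemma hardy_borel:
  fixes f \<sigma> w :: "real \<times> real \<Rightarrow> ennreal" and p q r :: real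
  defines "S \<equiv> (\<lambda>x. \<integral>\<^sup>+z. \<sigma> z * indicator (rect x) z \<partial>lborel)"
  defines "F \<equiv> (\<lambda>x. \<integral>\<^sup>+z. f z * indicator (rect x) z \<partial>lborel)"
  defines "H \<equiv> (\<lambda>z. \<integral>\<^sup>+x. S x ennpowr (q - 1) * w x * indicator (rect x) z \<partial>lborel)"
  assumes q: "1 < q" "q < p" and r: "1 / r = 1 / q - 1 / p"
    and [measurable]: "f \<in> borel_measurable borel" "\<sigma> \<in> borel_measurable borel" "w \<in> borel_measurable borel"
    and \<sigma>: "AE z in lborel. z \<in> R2plus \<longrightarrow> 0 < \<sigma> z \<and> \<sigma> z < top"
  shows "(\<integral>\<^sup>+x\<in>R2plus. F x ennpowr q * w x \<partial>lborel)
    \<le> (\<integral>\<^sup>+z\<in>R2plus. f z ennpowr p * \<sigma> z ennpowr (1 - p) \<partial>lborel) ennpowr (q / p)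
      * (\<integral>\<^sup>+z\<in>R2plus. \<sigma> z * H z ennpowr (r / q) \<partial>lborel) ennpowr (1 - q / p)"
proof -
  \<comment> \<open>Since r = p q / (p - q), the exponents p / q and r / q are conjugate.\<close>
  have qp: "0 < q / p" "q / p < 1" and rq: "r > 0" "r / q * (1 - q / p) = 1"
  proof -
    show "0 < q / p" "q / p < 1" using q by auto
    have "1 / r = (p - q) / (p * q)" using r q by (simp add: field_simps)
    then have req: "r = p * q / (p - q)" by (metis inverse_divide inverse_eq_divide inverse_inverse_eq)
    show "r > 0" using q by (simp add: req)
    show "r / q * (1 - q / p) = 1" using q by (simp add: req field_simps)
  qed
  \<comment> \<open>This is (f / \<sigma>)^q \<sigma>, the integrand produced by Jensen's inequality
    for f / \<sigma> with respect to the measure \<sigma> dz.\<close>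
  define g where "g z = f z ennpowr q * \<sigma> z ennpowr (1 - q)" for z
  define G where "G x = (\<integral>\<^sup>+z. g z * indicator (rect x) z \<partial>lborel)" for x
  have [measurable]: "g \<in> borel_measurable borel" unfolding g_def by measurable
  have [measurable]: "S \<in> borel_measurable borel" "F \<in> borel_measurable borel"
    "G \<in> borel_measurable borel" unfolding S_def F_def G_def by measurable
  have [measurable]: "H \<in> borel_measurable borel" unfolding H_def by measurable

  \<comment> \<open>Jensen's inequality is obtained as Hoelder's inequality for f = g^(1/q)
    \<sigma>^(1 - 1/q) on \<open>rect x\<close>, which also covers infinite integrals.\<close>
  have jensen: "F x ennpowr q \<le> G x * S x ennpowr (q - 1)" for x
  proof -
    have "F x = (\<integral>\<^sup>+z. (g z * indicator (rect x) z) ennpowr (1 / q)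
        * (\<sigma> z * indicator (rect x) z) ennpowr (1 - 1 / q) \<partial>lborel)"
      unfolding F_def
    proof (rule nn_integral_cong_AE, use \<sigma> in eventually_elim)
      case (elim z)
      show ?case
      proof (cases "z \<in> rect x")
        case True
        then have z: "0 < \<sigma> z" "\<sigma> z < top" using elim by (auto simp: R2plus_def)
        have "g z ennpowr (1 / q) * \<sigma> z ennpowr (1 - 1 / q)
            = f z * (\<sigma> z ennpowr ((1 - q) * (1 / q)) * \<sigma> z ennpowr (1 - 1 / q))"
          using q z by (simp add: g_def ennpowr_mult ennpowr_ennpowr mult.assoc)
        also have "\<dots> = f z"
          using q z by (subst ennpowr_add) (auto simp: field_simps ennpowr_def)
        finally show ?thesis using True by simp
      qed (use q in auto)
    qed
    also have "\<dots> \<le> G x ennpowr (1 / q) * S x ennpowr (1 - 1 / q)"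
      unfolding G_def S_def by (rule nn_integral_Hoelder) (use q in auto)
    finally have "F x ennpowr q \<le> (G x ennpowr (1 / q) * S x ennpowr (1 - 1 / q)) ennpowr q"
      using q by (intro ennpowr_mono) auto
    also have "\<dots> = G x * S x ennpowr ((1 - 1 / q) * q)"
      using q by (simp add: ennpowr_mult ennpowr_ennpowr)
    also have "(1 - 1 / q) * q = q - 1" using q by (simp add: field_simps)
    finally show ?thesis .
  qed

  have "(\<integral>\<^sup>+x\<in>R2plus. F x ennpowr q * w x \<partial>lborel) \<le> (\<integral>\<^sup>+x. G x * (S x ennpowr (q - 1) * w x) \<partial>lborel)"
    using jensen by (intro nn_integral_mono)
      (auto simp flip: mult.assoc split: split_indicator intro!: mult_right_mono)
  also have "\<dots> = (\<integral>\<^sup>+x. \<integral>\<^sup>+z. g z * (S x ennpowr (q - 1) * w x * indicator (rect x) z) \<partial>lborel \<partial>lborel)"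
    unfolding G_def by (subst nn_integral_multc[symmetric]) (auto simp: ac_simps)
  also have "\<dots> = (\<integral>\<^sup>+z. \<integral>\<^sup>+x. g z * (S x ennpowr (q - 1) * w x * indicator (rect x) z) \<partial>lborel \<partial>lborel)"
    by (rule lborel_pair.Fubini'[symmetric]) measurable
  also have "\<dots> = (\<integral>\<^sup>+z. g z * H z \<partial>lborel)"
    unfolding H_def by (subst nn_integral_cmult[symmetric]) auto
  \<comment> \<open>The splitting for Hoelder's inequality: \<sigma> collects the exponent (1 - p)
    q/p + (1 - q/p) = 1 - q, and H the exponent (r/q)(1 - q/p) = 1.\<close>
  also have "\<dots> = (\<integral>\<^sup>+z. (f z ennpowr p * \<sigma> z ennpowr (1 - p) * indicator R2plus z) ennpowr (q / p)
      * (\<sigma> z * H z ennpowr (r / q) * indicator R2plus z) ennpowr (1 - q / p) \<partial>lborel)"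
  proof (rule nn_integral_cong_AE, use \<sigma> in eventually_elim)
    case (elim z)
    show ?case
    proof (cases "z \<in> R2plus")
      case True
      then have z: "0 < \<sigma> z" "\<sigma> z < top" using elim by auto
      have "(f z ennpowr p * \<sigma> z ennpowr (1 - p)) ennpowr (q / p) * (\<sigma> z * H z ennpowr (r / q)) ennpowr (1 - q / p)
        = f z ennpowr (p * (q / p)) * \<sigma> z ennpowr ((1 - p) * (q / p))
          * (\<sigma> z ennpowr (1 - q / p) * H z ennpowr (r / q * (1 - q / p)))"
        using z qp q rq(1) by (simp add: ennpowr_mult ennpowr_ennpowr)
      also have "\<dots> = f z ennpowr q * (\<sigma> z ennpowr ((1 - p) * (q / p)) * \<sigma> z ennpowr (1 - q / p)) * H z"
        using q unfolding rq(2) by (simp add: ac_simps)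
      also have "\<sigma> z ennpowr ((1 - p) * (q / p)) * \<sigma> z ennpowr (1 - q / p)
          = \<sigma> z ennpowr ((1 - p) * (q / p) + (1 - q / p))"
        using z by (rule ennpowr_add)
      also have "(1 - p) * (q / p) + (1 - q / p) = 1 - q"
        using q by (simp add: field_simps)
      finally show ?thesis using True by (simp add: g_def)
    next
      case False
      \<comment> \<open>Every \<open>rect x\<close> lies inside the quadrant, so H vanishes outside
        it and the cut-off on the right loses nothing.\<close>
      then have "indicator (rect x) z = (0 :: ennreal)" for x
        by (auto simp: R2plus_def indicator_def mem_Times_iff)
      then have "H z = 0" by (simp add: H_def)
      then show ?thesis using False qp by simp
    qed
  qed
  also have "\<dots> \<le> (\<integral>\<^sup>+z\<in>R2plus. f z ennpowr p * \<sigma> z ennpowr (1 - p) \<partial>lborel) ennpowr (q / p)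
      * (\<integral>\<^sup>+z\<in>R2plus. \<sigma> z * H z ennpowr (r / q) \<partial>lborel) ennpowr (1 - q / p)"
    by (rule nn_integral_Hoelder[OF qp]) measurable
  finally show ?thesis .
qed

section \<open>The inequality for Lebesgue measurable weights\<close>

lemma ennreal_weight_measurable:
  assumes "weight_on_quadrant v"
  shows "(\<lambda>z. ennreal (v z)) \<in> borel_measurable (lebesgue_on R2plus)"
    and "sigma_weight p v \<in> borel_measurable (lebesgue_on R2plus)"
proof -
  show [measurable]: "(\<lambda>z. ennreal (v z)) \<in> borel_measurable (lebesgue_on R2plus)"
    using assms unfolding weight_on_quadrant_def by auto
  show "sigma_weight p v \<in> borel_measurable (lebesgue_on R2plus)"
    unfolding sigma_weight_def[abs_def] by measurable
qed

text \<open>The exponent 1 - p' = -1 / (p - 1) is negative, so the power could be 0 only at an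
  infinite value of v, and v is real-valued.\<close>

lemma sigma_weight_pos: "1 < p \<Longrightarrow> 0 < sigma_weight p v z"
  unfolding sigma_weight_def
  by (cases "ennreal (v z)" rule: ennreal_cases3)
    (auto simp: ennpowr_ennreal, auto simp: ennpowr_def conj_exponent_def field_simps)

text \<open>Because (1 - p')(1 - p) = 1, v is recovered from \<sigma>; this turns the norm of f in
  \<open>hardy_borel\<close> into the one weighted by v.\<close>

lemma sigma_weight_power:
  assumes "1 < p" "sigma_weight p v z < top"
  shows "sigma_weight p v z ennpowr (1 - p) = ennreal (v z)"
proof (cases "ennreal (v z)" rule: ennreal_cases3)
  case zero
  then have "sigma_weight p v z = top"
    using assms(1) by (auto simp: sigma_weight_def ennpowr_def conj_exponent_def field_simps)
  then show ?thesis using assms(2) by simp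
next
  case (pos t)
  have "(1 - conj_exponent p) * (1 - p) = 1"
    using assms(1) by (simp add: conj_exponent_def field_simps)
  then show ?thesis
    using pos by (simp add: sigma_weight_def ennpowr_ennpowr)
qed simp

text \<open>\<sigma> has a finite integral over each square with side n + 1 and is therefore finite
  almost everywhere there. Countably many such squares exhaust the quadrant.\<close>

lemma sigma_weight_finite_AE:
  assumes v: "weight_on_quadrant v" and fin: "\<forall>z\<in>R2plus. I2 (sigma_weight p v) z < top"
  shows "AE z in lborel. z \<in> R2plus \<longrightarrow> sigma_weight p v z < top"
proof -
  obtain \<sigma>' where [measurable]: "\<sigma>' \<in> borel_measurable borel"
    and eq: "AE z in lborel. z \<in> R2plus \<longrightarrow> sigma_weight p v z = \<sigma>' z"
    using borel_version[OF ennreal_weight_measurable(2)[OF v]] by blast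
  have "AE z in lborel. \<sigma>' z * indicator (rect (real (Suc n), real (Suc n))) z \<noteq> top" for n
  proof (rule nn_integral_PInf_AE[unfolded infinity_ennreal_def])
    have "(\<integral>\<^sup>+z. \<sigma>' z * indicator (rect (real (Suc n), real (Suc n))) z \<partial>lborel)
        = I2 (sigma_weight p v) (real (Suc n), real (Suc n))"
      unfolding I2_eq[OF ennreal_weight_measurable(2)[OF v]] by (rule rect_integral_cong[OF eq, symmetric])
    also have "\<dots> < top" using fin by (auto simp: R2plus_def)
    finally show "(\<integral>\<^sup>+z. \<sigma>' z * indicator (rect (real (Suc n), real (Suc n))) z \<partial>lborel) \<noteq> top"
      by simp
  qed measurable
  then have "AE z in lborel. \<forall>n. \<sigma>' z * indicator (rect (real (Suc n), real (Suc n))) z \<noteq> top"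
    by (simp add: AE_all_countable)
  with eq show ?thesis
  proof eventually_elim
    case (elim z)
    obtain n where n: "max (fst z) (snd z) < real n" using reals_Archimedean2 by blast
    then have "z \<in> R2plus \<Longrightarrow> z \<in> rect (real (Suc n), real (Suc n))"
      by (auto simp: R2plus_def mem_Times_iff)
    then show ?case using elim by (auto simp: less_top dest!: spec[of _ n])
  qed
qed

lemma hardy_inequality_B_v:
  assumes q: "1 < q" "q < p" and r: "1 / r = 1 / q - 1 / p"
    and v: "weight_on_quadrant v" and w: "weight_on_quadrant w"
    and fin: "\<forall>z\<in>R2plus. I2 (sigma_weight p v) z < top"
  shows "hardy_inequality p q v w (B_v p q r v w)"
  unfolding hardy_inequality_def
proof (intro allI impI)
  fix f :: "real \<times> real \<Rightarrow> ennreal" assume f: "f \<in> borel_measurable (lebesgue_on R2plus)"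
  define \<sigma> where "\<sigma> = sigma_weight p v"
  have \<sigma>_meas: "\<sigma> \<in> borel_measurable (lebesgue_on R2plus)"
    unfolding \<sigma>_def by (rule ennreal_weight_measurable(2)[OF v])
  obtain f' where [measurable]: "f' \<in> borel_measurable borel"
    and f': "AE z in lborel. z \<in> R2plus \<longrightarrow> f z = f' z" using borel_version[OF f] by blast
  obtain w' where [measurable]: "w' \<in> borel_measurable borel"
    and w': "AE z in lborel. z \<in> R2plus \<longrightarrow> ennreal (w z) = w' z"
    using borel_version[OF ennreal_weight_measurable(1)[OF w]] by blast
  obtain \<sigma>' where [measurable]: "\<sigma>' \<in> borel_measurable borel"
    and \<sigma>': "AE z in lborel. z \<in> R2plus \<longrightarrow> \<sigma> z = \<sigma>' z" using borel_version[OF \<sigma>_meas] by blast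
  have \<sigma>_fin: "AE z in lborel. z \<in> R2plus \<longrightarrow> \<sigma> z < top"
    unfolding \<sigma>_def by (rule sigma_weight_finite_AE[OF v fin])
  have \<sigma>'_pos_fin: "AE z in lborel. z \<in> R2plus \<longrightarrow> 0 < \<sigma>' z \<and> \<sigma>' z < top"
    using \<sigma>' \<sigma>_fin
  proof eventually_elim
    case (elim z)
    then show ?case using sigma_weight_pos[of p v z] q by (auto simp: \<sigma>_def)
  qed
  define S where "S x = (\<integral>\<^sup>+z. \<sigma>' z * indicator (rect x) z \<partial>lborel)" for x
  define F where "F x = (\<integral>\<^sup>+z. f' z * indicator (rect x) z \<partial>lborel)" for x
  define H where "H z = (\<integral>\<^sup>+x. S x ennpowr (q - 1) * w' x * indicator (rect x) z \<partial>lborel)" for z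
  define K where "K = I2_star (\<lambda>x. I2 \<sigma> x ennpowr (q - 1) * ennreal (w x))"
  have [measurable]: "S \<in> borel_measurable borel" unfolding S_def by measurable
  \<comment> \<open>Changing an integrand on a null set leaves the integral unchanged, so these
    equalities hold at every point and not only almost everywhere.\<close>
  have I2f: "I2 f = F"
    unfolding fun_eq_iff F_def by (simp add: I2_eq[OF f] rect_integral_cong[OF f'])
  have I2\<sigma>: "I2 \<sigma> = S"
    unfolding fun_eq_iff S_def by (simp add: I2_eq[OF \<sigma>_meas] rect_integral_cong[OF \<sigma>'])
  have K: "K z = H z" if z: "z \<in> R2plus" for z
  proof -
    have [measurable]: "S \<in> borel_measurable (lebesgue_on R2plus)"
      by (rule measurable_restrict_space1) (simp add: measurable_completion)
    have "(\<lambda>x. S x ennpowr (q - 1) * ennreal (w x)) \<in> borel_measurable (lebesgue_on R2plus)"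
      using ennreal_weight_measurable(1)[OF w] by measurable
    from I2_star_eq[OF this z] show ?thesis
      unfolding K_def H_def I2\<sigma>
      by (simp, intro nn_integral_cong_AE, use w' in eventually_elim)
        (auto simp: rect_indicator R2plus_def)
  qed
  have weighted: "(\<integral>\<^sup>+z\<in>R2plus. I2 f z ennpowr q * ennreal (w z) \<partial>lebesgue)
      = (\<integral>\<^sup>+x\<in>R2plus. F x ennpowr q * w' x \<partial>lborel)"
    unfolding I2f nn_integral_completion
    by (rule nn_integral_cong_AE, use w' in eventually_elim) (auto split: split_indicator)
  let ?X = "\<integral>\<^sup>+z\<in>R2plus. f z ennpowr p * ennreal (v z) \<partial>lebesgue"
  let ?Y = "\<integral>\<^sup>+z\<in>R2plus. \<sigma> z * K z ennpowr (r / q) \<partial>lebesgue"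
  have X: "?X = (\<integral>\<^sup>+z\<in>R2plus. f' z ennpowr p * \<sigma>' z ennpowr (1 - p) \<partial>lborel)"
    unfolding nn_integral_completion
  proof (rule nn_integral_cong_AE, use f' \<sigma>' \<sigma>_fin in eventually_elim)
    case (elim z)
    show ?case
    proof (cases "z \<in> R2plus")
      case True
      with elim have "\<sigma>' z ennpowr (1 - p) = ennreal (v z)"
        using sigma_weight_power[of p v z] q by (auto simp: \<sigma>_def)
      then show ?thesis using True elim by simp
    qed simp
  qed
  have Y: "?Y = (\<integral>\<^sup>+z\<in>R2plus. \<sigma>' z * H z ennpowr (r / q) \<partial>lborel)"
    unfolding nn_integral_completion
    by (rule nn_integral_cong_AE, use \<sigma>' in eventually_elim) (auto simp: K split: split_indicator)
  have "(\<integral>\<^sup>+x\<in>R2plus. F x ennpowr q * w' x \<partial>lborel) \<le> ?X ennpowr (q / p) * ?Y ennpowr (1 - q / p)"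
    unfolding X Y F_def H_def S_def by (rule hardy_borel) (use q r \<sigma>'_pos_fin in auto)
  then have "(\<integral>\<^sup>+z\<in>R2plus. I2 f z ennpowr q * ennreal (w z) \<partial>lebesgue) ennpowr (1 / q)
      \<le> (?X ennpowr (q / p) * ?Y ennpowr (1 - q / p)) ennpowr (1 / q)"
    unfolding weighted using q by (intro ennpowr_mono) auto
  also have "\<dots> = ?X ennpowr (q / p * (1 / q)) * ?Y ennpowr ((1 - q / p) * (1 / q))"
    using q by (simp add: ennpowr_mult ennpowr_ennpowr)
  also have "q / p * (1 / q) = 1 / p" using q by simp
  \<comment> \<open>The root of order q gives 1/q - 1/p = 1/r, exactly the outer exponent of
    \<open>B_v\<close>.\<close>
  also have "(1 - q / p) * (1 / q) = 1 / r" using q r by (simp add: field_simps)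
  finally show "(\<integral>\<^sup>+z\<in>R2plus. I2 f z ennpowr q * ennreal (w z) \<partial>lebesgue) ennpowr (1 / q)
      \<le> B_v p q r v w * ?X ennpowr (1 / p)"
    by (simp add: B_v_def \<sigma>_def K_def mult.commute)
qed

section \<open>The least constant is attained\<close>

text \<open>
  If the infimum of the admissible constants is \<open>0\<close>, the inequality with constant \<open>0\<close> is not
  immediate for \<open>f\<close> of infinite norm, because \<open>0 * \<infinity> = 0\<close>. Testing with \<open>\<sigma>\<close> on the unit square,
  which has finite norm and positive \<open>I2\<close>, shows that \<open>w\<close> vanishes almost everywhere in this case.
\<close>

lemma least_constant_bound:
  assumes f: "f \<in> borel_measurable (lebesgue_on R2plus)"
    and fin: "least_constant p q v w < top"
      "(\<integral>\<^sup>+z\<in>R2plus. f z ennpowr p * ennreal (v z) \<partial>lebesgue) ennpowr (1 / p) < top" (is "?X < _")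
  shows "(\<integral>\<^sup>+z\<in>R2plus. I2 f z ennpowr q * ennreal (w z) \<partial>lebesgue) ennpowr (1 / q)
    \<le> least_constant p q v w * ?X" (is "?L \<le> _")
proof -
  let ?A = "{C. C < top \<and> hardy_inequality p q v w C}"
  have le: "?L \<le> C * ?X" if "C \<in> ?A" for C
    using that f by (simp add: hardy_inequality_def)
  obtain C where C: "C \<in> ?A"
    using fin(1) unfolding least_constant_def by (metis Inf_less_iff)
  show ?thesis
  \<comment> \<open>For \<open>?X = 0\<close> a single admissible C already forces the left side to
    be 0. Otherwise \<open>?X\<close> is positive and finite, so dividing by it bounds every
    admissible constant below by \<open>?L / ?X\<close>, and the infimum inherits this
    bound.\<close>
  proof (cases "?X = 0")
    case True
    then show ?thesis using le[OF C] by simp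
  next
    case False
    then have "?L / ?X \<le> C" if "C \<in> ?A" for C
      using le[OF that] by (intro divide_le_posI_ennreal) (auto simp: zero_less_iff_neq_zero mult.commute)
    then have "?L / ?X \<le> least_constant p q v w"
      unfolding least_constant_def by (rule Inf_greatest)
    then have "?L / ?X * ?X \<le> least_constant p q v w * ?X"
      by (rule mult_right_mono) simp
    then show ?thesis
      using False fin(2) by (simp add: ennreal_divide_times)
  qed
qed

lemma weight_null_if_least_constant_0:
  assumes q: "1 < q" "q < p"
    and v: "weight_on_quadrant v" and w: "weight_on_quadrant w"
    and fin: "\<forall>z\<in>R2plus. I2 (sigma_weight p v) z < top"
    and zero: "least_constant p q v w = 0"
  shows "AE z in lborel. z \<in> R2plus \<longrightarrow> w z = 0"
proof -
  define \<sigma> where "\<sigma> = sigma_weight p v"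
  have [measurable]: "\<sigma> \<in> borel_measurable (lebesgue_on R2plus)"
    unfolding \<sigma>_def by (rule ennreal_weight_measurable(2)[OF v])
  define f where "f z = \<sigma> z * indicator (rect (1, 1)) z" for z
  have "rect (1, 1) \<in> sets lebesgue"
    by (intro sets_completionI_sets) (auto intro!: borel_open open_Times)
  have f: "f \<in> borel_measurable (lebesgue_on R2plus)"
    unfolding f_def by (rule borel_measurable_times_ennreal)
      (fact | rule measurable_restrict_space1 borel_measurable_indicator)+
  let ?L = "\<integral>\<^sup>+z\<in>R2plus. I2 f z ennpowr q * ennreal (w z) \<partial>lebesgue"
  let ?X = "\<integral>\<^sup>+z\<in>R2plus. f z ennpowr p * ennreal (v z) \<partial>lebesgue"
  \<comment> \<open>On the unit square f^p v = \<sigma>^p \<sigma>^(1 - p) = \<sigma>, so the test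
    function has finite norm.\<close>
  have "?X = I2 \<sigma> (1, 1)"
    unfolding nn_integral_completion \<sigma>_def I2_eq[OF ennreal_weight_measurable(2)[OF v]]
  proof (rule nn_integral_cong_AE, use sigma_weight_finite_AE[OF v fin] in eventually_elim)
    case (elim z)
    show ?case
    proof (cases "z \<in> rect (1, 1)")
      case True
      then have z: "z \<in> R2plus" by (auto simp: R2plus_def)
      with elim q have "sigma_weight p v z ennpowr p * ennreal (v z)
          = sigma_weight p v z ennpowr p * sigma_weight p v z ennpowr (1 - p)"
        by (simp add: sigma_weight_power)
      also have "\<dots> = sigma_weight p v z"
        using elim z q by (simp add: ennpowr_add sigma_weight_pos)
      finally show ?thesis using True z by (simp add: f_def \<sigma>_def)
    qed (use q in \<open>simp add: f_def\<close>)
  qed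
  also have "\<dots> < top" using fin by (auto simp: \<sigma>_def R2plus_def)
  finally have X: "?X ennpowr (1 / p) < top" using q by (intro ennpowr_less_top) auto
  have "?L ennpowr (1 / q) \<le> least_constant p q v w * ?X ennpowr (1 / p)"
    by (rule least_constant_bound[OF f _ X]) (simp add: zero)
  then have "?L = 0" using zero q by (simp add: ennpowr_eq_0_iff)
  have I2f: "0 < I2 f x" if x: "x \<in> R2plus" for x
  proof -
    \<comment> \<open>\<open>rect m\<close> is the intersection of \<open>rect x\<close> with the
      unit square: open and nonempty, hence not null, so the positive function \<sigma> has a
      positive integral over it.\<close>
    define m where "m = (min (fst x) 1, min (snd x) 1)"
    obtain \<sigma>' where [measurable]: "\<sigma>' \<in> borel_measurable borel"
      and \<sigma>': "AE z in lborel. z \<in> R2plus \<longrightarrow> \<sigma> z = \<sigma>' z"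
      using borel_version[of \<sigma>] by auto
    have "I2 f x = (\<integral>\<^sup>+z. \<sigma> z * indicator (rect m) z \<partial>lborel)"
      unfolding I2_eq[OF f] f_def m_def by (intro nn_integral_cong) (auto simp: indicator_def mem_Times_iff)
    also have "\<dots> = (\<integral>\<^sup>+z. \<sigma>' z * indicator (rect m) z \<partial>lborel)" by (rule rect_integral_cong[OF \<sigma>'])
    finally have eq: "I2 f x = (\<integral>\<^sup>+z. \<sigma>' z * indicator (rect m) z \<partial>lborel)" .
    show ?thesis
    proof (rule ccontr)
      assume "\<not> 0 < I2 f x"
      then have "AE z in lborel. \<sigma>' z * indicator (rect m) z = 0"
        unfolding eq by (subst nn_integral_0_iff_AE[symmetric]) (auto simp: zero_less_iff_neq_zero)
      then have "AE z in lborel. z \<notin> rect m"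
        using \<sigma>'
      proof eventually_elim
        case (elim z)
        then show ?case
          using sigma_weight_pos[of p v z] q by (auto simp: \<sigma>_def R2plus_def)
      qed
      moreover have rect: "open (rect m)" by (intro open_Times) auto
      ultimately have "rect m \<in> null_sets lborel" by (subst AE_iff_null_sets) auto
      then have "negligible (rect m)" by (simp add: negligible_iff_null_sets null_sets_completionI)
      with rect have "rect m = {}" using open_not_negligible by blast
      then show False using x by (auto simp: m_def R2plus_def)
    qed
  qed
  obtain w' where [measurable]: "w' \<in> borel_measurable borel"
    and w': "AE z in lborel. z \<in> R2plus \<longrightarrow> ennreal (w z) = w' z"
    using borel_version[OF ennreal_weight_measurable(1)[OF w]] by blast
  obtain f' where [measurable]: "f' \<in> borel_measurable borel"
    and f': "AE z in lborel. z \<in> R2plus \<longrightarrow> f z = f' z" using borel_version[OF f] by blast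
  define F where "F x = (\<integral>\<^sup>+z. f' z * indicator (rect x) z \<partial>lborel)" for x
  have F: "I2 f = F" unfolding fun_eq_iff F_def by (simp add: I2_eq[OF f] rect_integral_cong[OF f'])
  have [measurable]: "F \<in> borel_measurable borel" unfolding F_def by measurable
  have "?L = (\<integral>\<^sup>+z\<in>R2plus. F z ennpowr q * w' z \<partial>lborel)"
    unfolding F nn_integral_completion
    by (rule nn_integral_cong_AE, use w' in eventually_elim) (auto split: split_indicator)
  with \<open>?L = 0\<close> have "(\<integral>\<^sup>+z\<in>R2plus. F z ennpowr q * w' z \<partial>lborel) = 0" by simp
  then have "AE z in lborel. F z ennpowr q * w' z * indicator R2plus z = 0"
    by (subst (asm) nn_integral_0_iff_AE) auto
  with w' show ?thesis
  proof eventually_elim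
    case (elim z)
    show ?case
    proof
      assume z: "z \<in> R2plus"
      then have "ennreal (w z) = 0"
        using elim I2f[OF z] q by (auto simp: F ennpowr_eq_0_iff)
      then show "w z = 0" using w z by (auto simp: weight_on_quadrant_def ennreal_eq_0_iff intro: antisym)
    qed
  qed
qed

theorem theorem3p1:
  fixes p q r :: real
  assumes "1 < q" and "q < p" and "1 / r = 1 / q - 1 / p"
  shows "\<exists>c::real. c > 0 \<and>
    (\<forall>v w :: real \<times> real \<Rightarrow> real.
       weight_on_quadrant v \<longrightarrow> weight_on_quadrant w \<longrightarrow>
       (\<forall>z\<in>R2plus. I2 (sigma_weight p v) z < top) \<longrightarrow>
       (\<forall>z\<in>R2plus. I2_star (\<lambda>x. ennreal (w x)) z < top) \<longrightarrow>
       B_v p q r v w < top \<longrightarrow>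
       least_constant p q v w < top \<and>
       hardy_inequality p q v w (least_constant p q v w) \<and>
       least_constant p q v w \<le> ennreal c * B_v p q r v w)"
proof (intro exI[of _ 1] conjI allI impI)
  fix v w :: "real \<times> real \<Rightarrow> real"
  assume v: "weight_on_quadrant v" and w: "weight_on_quadrant w"
    and fin: "\<forall>z\<in>R2plus. I2 (sigma_weight p v) z < top"
    and B: "B_v p q r v w < top"
  have hardy_B: "hardy_inequality p q v w (B_v p q r v w)"
    by (rule hardy_inequality_B_v[OF assms v w fin])
  \<comment> \<open>Finiteness of \<open>B_v\<close> makes it a member of the set whose infimum is
    the least constant.\<close>
  then have least_le: "least_constant p q v w \<le> ennreal 1 * B_v p q r v w"
    unfolding least_constant_def using B by (auto intro!: Inf_lower)
  then show "least_constant p q v w \<le> ennreal 1 * B_v p q r v w" .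
  show "least_constant p q v w < top" using least_le B by auto
  show "hardy_inequality p q v w (least_constant p q v w)"
    unfolding hardy_inequality_def
  proof (intro allI impI)
    fix f :: "real \<times> real \<Rightarrow> ennreal" assume f: "f \<in> borel_measurable (lebesgue_on R2plus)"
    let ?L = "\<integral>\<^sup>+z\<in>R2plus. I2 f z ennpowr q * ennreal (w z) \<partial>lebesgue"
    let ?X = "\<integral>\<^sup>+z\<in>R2plus. f z ennpowr p * ennreal (v z) \<partial>lebesgue"
    show "?L ennpowr (1 / q) \<le> least_constant p q v w * ?X ennpowr (1 / p)"
    \<comment> \<open>For infinite norm the right side is infinite if the least constant is
      positive. If that constant is 0, the right side is 0 by convention, and the left side is 0
      because w vanishes almost everywhere.\<close>
    proof (cases "?X ennpowr (1 / p) < top")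
      case True
      then show ?thesis by (rule least_constant_bound[OF f \<open>least_constant p q v w < top\<close>])
    next
      case False
      show ?thesis
      proof (cases "least_constant p q v w = 0")
        case True
        have "?L = integral\<^sup>N lborel (\<lambda>_ :: real \<times> real. 0)"
          unfolding nn_integral_completion
          by (rule nn_integral_cong_AE, use weight_null_if_least_constant_0[OF assms(1,2) v w fin True]
              in eventually_elim) (auto split: split_indicator)
        then show ?thesis using assms by simp
      next
        assume "least_constant p q v w \<noteq> 0"
        then show ?thesis using False by (simp add: ennreal_mult_top flip: less_top)
      qed
    qed
  qed
qed simp

end
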